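(* Let $X$ be a finite dimensional normed space, $A\subset X$ be a closed set, and let the functions $f$ and $\varphi$ be lower semicontinuous on $A$. Then the penalty function $F_\lambda=f+\lambda\varphi$ is (globally) exact if and only if the following two conditions are satisfied: (1) $F_\lambda$ is non-degenerate; (2) $F_\lambda$ is exact at every globally optimal solution $x^*$ of the problem $(\mathcal{P})$: $\min f(x)$ subject to $x\in M$, $x\in A$.
   Context: $M,A\subset X$ are nonempty, $f\colon X\to\mathbb{R}\cup\{+\infty\}$, $\varphi\colon X\to[0,+\infty)$ with $M=\{x\in X\mid\varphi(x)=0\}$, $\Omega=M\cap A$, $F_\lambda(x)=f(x)+\lambda\varphi(x)$ for $\lambda\ge0$. Standing assumptions: $f(x)<+\infty$ for some $x\in\Omega$, and $f$ attains a global minimum on $\Omega$. $G(\lambda)$ denotes the (possibly empty) set of global minimizers of $F_\lambda$ on $A$. The penalty function $F_\lambda$ is non-degenerate if there exists $\lambda_0\ge0$ such that for every $\lambda\ge\lambda_0$ the function $F_\lambda$ attains a global minimum on $A$, and there exists a selection $x(\cdot)$ of $G(\cdot)$ (i.e. $x(\lambda)\in G(\lambda)$) such that the set $\{x(\lambda)\mid\lambda\ge\lambda_0\}$ is bounded. $F_\lambda$ is (globally) exact if there exists $\lambda_0\ge0$ such that for every $\lambda>\lambda_0$ the set of global minimizers of $F_\lambda$ on $A$ coincides with the set of globally optimal solutions of $(\mathcal{P})$. It is exact at a point $x^*$ (a locally, in particular globally, optimal solution of $(\mathcal{P})$) if there exists $\lambda^*\ge0$ such that $x^*$ is a point of local minimum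 of $F_{\lambda^*}$ on $A$. *)

theory Defs
  imports "HOL-Analysis.Analysis"
begin

definition lower_semicontinuous_on ::
    "'a::topological_space set \<Rightarrow> ('a \<Rightarrow> 'b::linorder_topology) \<Rightarrow> bool" where
  "lower_semicontinuous_on A g \<longleftrightarrow>
     (\<forall>x\<in>A. \<forall>c < g x. \<forall>\<^sub>F y in at x within A. c < g y)"

definition global_minimizers :: "('a \<Rightarrow> ereal) \<Rightarrow> 'a set \<Rightarrow> 'a set" where
  "global_minimizers g S = {x. is_arg_min g (\<lambda>y. y \<in> S) x}"

definition local_minimizer_on ::
    "('a::metric_space \<Rightarrow> ereal) \<Rightarrow> 'a set \<Rightarrow> 'a \<Rightarrow> bool" where
  "local_minimizer_on g S x \<longleftrightarrow> x \<in> S \<and> (\<exists>r>0. \<forall>y \<in> S \<inter> ball x r. g x \<le> g y)"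

text \<open>The value \<open>+\<infinity>\<close> of the objective is the \<^typ>\<open>ereal\<close> \<open>\<infinity>\<close>; the value \<open>-\<infinity>\<close> has to be
  excluded by a separate assumption on \<open>f\<close>.\<close>

definition penalty_fun :: "('a \<Rightarrow> ereal) \<Rightarrow> ('a \<Rightarrow> real) \<Rightarrow> real \<Rightarrow> 'a \<Rightarrow> ereal" where
  "penalty_fun f \<phi> l x = f x + ereal (l * \<phi> x)"

text \<open>A selection need only be defined for \<open>l \<ge> l0\<close>; the values of the total function \<open>x\<close>
  below \<open>l0\<close> are irrelevant.\<close>

definition non_degenerate ::
    "('a::metric_space \<Rightarrow> ereal) \<Rightarrow> ('a \<Rightarrow> real) \<Rightarrow> 'a set \<Rightarrow> bool" where
  "non_degenerate f \<phi> A \<longleftrightarrow>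
     (\<exists>l0\<ge>0. (\<forall>l\<ge>l0. global_minimizers (penalty_fun f \<phi> l) A \<noteq> {}) \<and>
        (\<exists>x :: real \<Rightarrow> 'a. (\<forall>l\<ge>l0. x l \<in> global_minimizers (penalty_fun f \<phi> l) A) \<and>
           bounded (x ` {l0..})))"

definition globally_exact ::
    "('a \<Rightarrow> ereal) \<Rightarrow> ('a \<Rightarrow> real) \<Rightarrow> 'a set \<Rightarrow> 'a set \<Rightarrow> bool" where
  "globally_exact f \<phi> M A \<longleftrightarrow>
     (\<exists>l0\<ge>0. \<forall>l>l0. global_minimizers (penalty_fun f \<phi> l) A = global_minimizers f (M \<inter> A))"

definition exact_at ::
    "('a::metric_space \<Rightarrow> ereal) \<Rightarrow> ('a \<Rightarrow> real) \<Rightarrow> 'a set \<Rightarrow> 'a \<Rightarrow> bool" where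
  "exact_at f \<phi> A xs \<longleftrightarrow> (\<exists>l\<ge>0. local_minimizer_on (penalty_fun f \<phi> l) A xs)"

end

theory Submission
  imports Defs
begin

text \<open>If some \<open>F\<^sub>N\<close> is bounded below on \<open>A\<close> by the optimal value \<open>m\<close>, then for \<open>l > N\<close>
  the surplus \<open>(l - N) \<phi>\<close> forces every minimizer of \<open>F\<^sub>l\<close> to be feasible, so the penalty is exact.
  Such an \<open>N\<close> exists since cluster points, for \<open>l \<rightarrow> \<infinity>\<close>, of a bounded selection of minimizers
  are optimal by lower semicontinuity; local exactness at one cluster point gives the lower bound
  \<open>m\<close> at all selected minimizers near it, hence \<open>min F\<^sub>l \<ge> m\<close> for one of their parameters.\<close>

text \<open>Induction on \<open>B\<close>. A new vector \<open>b\<close> outside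
  \<open>span B\<close> has positive distance to it, so a bound on \<open>t *\<^sub>R b + y\<close>
  bounds both \<open>t\<close> and \<open>y\<close>, and the ball is a closed part of the image of a
  compact product.\<close>

lemma compact_span_Int_cball:
  fixes B :: "'a::real_normed_vector set"
  assumes "finite B"
  shows "compact (span B \<inter> cball 0 r)"
  using assms
proof (induction B arbitrary: r rule: finite_induct)
  case empty
  then show ?case
    by (cases "0 \<le> r") auto
next
  case (insert b B)
  show ?case
  proof (cases "b \<in> span B")
    case True
    then show ?thesis
      using insert.IH by (simp add: span_redundant)
  next
    case False
    \<comment> \<open>\<open>?K\<close> is compact by induction, hence at positive distance
      \<open>e\<close> from \<open>b\<close>. Points of \<open>span B\<close> outside it are farther
      than 1 from \<open>b\<close>, whence the minimum with 1 in \<open>d\<close>.\<close>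
    let ?K = "span B \<inter> cball 0 (norm b + 1)"
    have "closed ?K" "b \<notin> ?K"
      using insert.IH False by (auto intro: compact_imp_closed)
    then obtain e where "e > 0" "ball b e \<subseteq> - ?K"
      by (meson ComplI open_Compl open_contains_ball)
    then have e: "e > 0" "\<And>y. y \<in> ?K \<Longrightarrow> e \<le> dist b y"
      by (auto simp: not_less[symmetric])
    define d where "d = min e 1"
    have d: "d > 0" using e by (simp add: d_def)
    have dist_ge: "d \<le> norm (b + y)" if "y \<in> span B" for y
    proof (cases "norm y \<le> norm b + 1")
      case True
      then have "- y \<in> ?K" using that by (simp add: span_neg)
      then show ?thesis using e(2)[of "- y"] by (simp add: dist_norm d_def)
    next
      case False
      have "norm y \<le> norm (b + y) + norm b"
        by (metis add_diff_cancel_left' norm_triangle_ineq4)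
      then show ?thesis using False by (simp add: d_def)
    qed
    \<comment> \<open>Homogeneity: dividing by \<open>t\<close> reduces this to
      \<open>dist_ge\<close>.\<close>
    have coord: "\<bar>t\<bar> * d \<le> norm (t *\<^sub>R b + y)" if "y \<in> span B" for t y
    proof (cases "t = 0")
      case False
      have "t *\<^sub>R b + y = t *\<^sub>R (b + (1 / t) *\<^sub>R y)"
        using False by (simp add: scaleR_add_right)
      then have "norm (t *\<^sub>R b + y) = \<bar>t\<bar> * norm (b + (1 / t) *\<^sub>R y)"
        by (metis norm_scaleR)
      then show ?thesis
        using dist_ge[OF span_scale[OF that]] by (simp add: mult_left_mono)
    qed simp
    \<comment> \<open>\<open>coord\<close> bounds \<open>t\<close> by \<open>r / d\<close>, and the
      triangle inequality then bounds \<open>y\<close>. The image may leave the ball of radius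
      \<open>r\<close>, so it is cut down again below.\<close>
    let ?P = "{- (r / d) .. r / d} \<times> (span B \<inter> cball 0 (r + r / d * norm b))"
    let ?S = "(\<lambda>(t, y). t *\<^sub>R b + y) ` ?P"
    have "compact ?S"
      by (intro compact_continuous_image compact_Times compact_Icc insert.IH)
         (auto simp: split_def intro!: continuous_intros)
    moreover have "span (insert b B) \<inter> cball 0 r = ?S \<inter> cball 0 r"
    proof (intro equalityI subsetI)
      fix x assume x: "x \<in> span (insert b B) \<inter> cball 0 r"
      then obtain t where t: "x - t *\<^sub>R b \<in> span B"
        by (auto simp: span_breakdown_eq)
      have "\<bar>t\<bar> * d \<le> r"
        using coord[OF t, of t] x by simp
      then have tr: "\<bar>t\<bar> \<le> r / d" using d by (simp add: pos_le_divide_eq)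
      have "norm (x - t *\<^sub>R b) \<le> norm x + \<bar>t\<bar> * norm b"
        using norm_triangle_ineq4[of x "t *\<^sub>R b"] by simp
      also have "\<dots> \<le> r + r / d * norm b"
        using x tr by (intro add_mono mult_right_mono) auto
      finally have "(t, x - t *\<^sub>R b) \<in> ?P"
        using t tr by auto
      then have "x \<in> ?S"
        by (rule rev_image_eqI) simp
      then show "x \<in> ?S \<inter> cball 0 r" using x by blast
    next
      fix x assume "x \<in> ?S \<inter> cball 0 r"
      then show "x \<in> span (insert b B) \<inter> cball 0 r"
        by (auto intro!: span_add span_scale intro: span_base subsetD[OF span_mono[OF subset_insertI]])
    qed
    ultimately show ?thesis
      by (simp add: compact_Int_closed)
  qed
qed

lemma compact_cball_finite_dimensional:
  assumes "\<exists>B :: 'a::real_normed_vector set. finite_dimensional_vector_space (*\<^sub>R) B"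
  shows "compact (cball (0::'a) r)"
proof -
  obtain B :: "'a set" where "finite_dimensional_vector_space (*\<^sub>R) B"
    using assms by blast
  then interpret fd: finite_dimensional_vector_space "(*\<^sub>R)" B .
  have "span B = UNIV"
    using fd.span_Basis by (simp add: span_raw_def)
  then show ?thesis
    using compact_span_Int_cball[OF fd.finite_Basis, of r] by simp
qed

text \<open>The form in which semicontinuity is used: upper bounds pass to limits.\<close>

lemma lower_semicontinuous_on_sequentially_le:
  assumes "lower_semicontinuous_on A g" "x \<in> A" "\<And>n. X n \<in> A" "X \<longlonglongrightarrow> x"
    and "\<forall>\<^sub>F n in sequentially. g (X n) \<le> c"
  shows "g x \<le> c"
proof (rule ccontr)
  assume "\<not> g x \<le> c"
  then have "\<forall>\<^sub>F y in at x within A. c < g y"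
    using assms(1,2) by (auto simp: lower_semicontinuous_on_def)
  \<comment> \<open>\<open>at x within A\<close> omits \<open>x\<close> itself; terms equal to
    \<open>x\<close> violate the bound directly, since \<open>c < g x\<close>.\<close>
  then have "\<forall>\<^sub>F y in nhds x. y \<noteq> x \<longrightarrow> y \<in> A \<longrightarrow> c < g y"
    by (simp add: eventually_at_filter)
  then have "\<forall>\<^sub>F n in sequentially. X n \<noteq> x \<longrightarrow> X n \<in> A \<longrightarrow> c < g (X n)"
    using assms(4) by (rule eventually_compose_filterlim)
  then have "\<forall>\<^sub>F n in sequentially. False"
    using assms(5) by eventually_elim (use assms(3) \<open>\<not> g x \<le> c\<close> in force)
  then show False by simp
qed

lemma mem_global_minimizers_iff:
  "x \<in> global_minimizers g S \<longleftrightarrow> x \<in> S \<and> (\<forall>y\<in>S. g x \<le> g y)"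
  by (auto simp: global_minimizers_def is_arg_min_linorder)

lemma penalty_fun_feasible: "\<phi> x = 0 \<Longrightarrow> penalty_fun f \<phi> l x = f x"
  by (simp add: penalty_fun_def zero_ereal_def[symmetric])

lemma penalty_fun_diff:
  "penalty_fun f \<phi> l x = penalty_fun f \<phi> k x + ereal ((l - k) * \<phi> x)"
  by (cases "f x") (auto simp: penalty_fun_def algebra_simps)

text \<open>On feasible points F_N equals \<open>f\<close>, so \<open>lower\<close> itself makes
  \<open>m\<close> the optimal value and \<open>x0\<close> a solution.\<close>

lemma globally_exactI:
  assumes "\<And>x. 0 \<le> \<phi> x" and M: "M = {x. \<phi> x = 0}"
    and x0: "x0 \<in> M \<inter> A" "f x0 = ereal m"
    and "0 \<le> N" and lower: "\<And>y. y \<in> A \<Longrightarrow> ereal m \<le> penalty_fun f \<phi> N y"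
  shows "globally_exact f \<phi> M A"
  unfolding globally_exact_def
proof (intro exI conjI allI impI set_eqI)
  show "0 \<le> N" by fact
  fix l x assume l: "N < l"
  have ge: "ereal (m + (l - N) * \<phi> y) \<le> penalty_fun f \<phi> l y" if "y \<in> A" for y
    using add_right_mono[OF lower[OF that], of "ereal ((l - N) * \<phi> y)"]
    by (simp add: penalty_fun_diff[of f \<phi> l y N])
  have ge_m: "ereal m \<le> penalty_fun f \<phi> l y" if "y \<in> A" for y
    using ge[OF that] l assms(1)[of y]
    by (rule_tac order_trans[of _ "ereal (m + (l - N) * \<phi> y)"]) auto
  have feas: "penalty_fun f \<phi> l y = f y" if "y \<in> M" for y
    using that M by (simp add: penalty_fun_feasible)
  show "x \<in> global_minimizers (penalty_fun f \<phi> l) A \<longleftrightarrow> x \<in> global_minimizers f (M \<inter> A)"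
  proof
    assume x: "x \<in> global_minimizers (penalty_fun f \<phi> l) A"
    then have "penalty_fun f \<phi> l x \<le> ereal m"
      using x0 feas[of x0] by (metis IntD1 IntD2 mem_global_minimizers_iff)
    moreover have "ereal (m + (l - N) * \<phi> x) \<le> penalty_fun f \<phi> l x"
      using ge x by (simp add: mem_global_minimizers_iff)
    ultimately have "ereal (m + (l - N) * \<phi> x) \<le> ereal m"
      by (rule order_trans[rotated])
    \<comment> \<open>The real number \<open>m\<close> cancels; strictness of \<open>N < l\<close>
      then forces \<open>\<phi> x = 0\<close>.\<close>
    then have "(l - N) * \<phi> x \<le> 0" by simp
    then have "\<phi> x = 0"
      using l assms(1)[of x] by (simp add: mult_le_0_iff)
    then have "x \<in> M" using M by simp
    then show "x \<in> global_minimizers f (M \<inter> A)"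
      using x feas by (fastforce simp: mem_global_minimizers_iff)
  next
    assume x: "x \<in> global_minimizers f (M \<inter> A)"
    then have "penalty_fun f \<phi> l x \<le> ereal m"
      using x0 feas[of x] by (metis IntD1 mem_global_minimizers_iff)
    then show "x \<in> global_minimizers (penalty_fun f \<phi> l) A"
      using x ge_m by (auto simp: mem_global_minimizers_iff intro: order_trans)
  qed
qed

text \<open>One optimal solution minimizes every F_l beyond the threshold, so a constant selection
  is bounded; global minimizers are also local ones.\<close>

lemma globally_exactD:
  assumes exact: "globally_exact f \<phi> M A" and attained: "global_minimizers f (M \<inter> A) \<noteq> {}"
  shows "non_degenerate f \<phi> A" "\<forall>xs\<in>global_minimizers f (M \<inter> A). exact_at f \<phi> A xs"
proof -
  obtain k where k: "0 \<le> k"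
    and eq: "\<And>l. l > k \<Longrightarrow> global_minimizers (penalty_fun f \<phi> l) A = global_minimizers f (M \<inter> A)"
    using exact by (auto simp: globally_exact_def)
  obtain x0 where x0: "x0 \<in> global_minimizers f (M \<inter> A)"
    using attained by blast
  show "non_degenerate f \<phi> A"
    unfolding non_degenerate_def
  proof (intro exI conjI)
    \<comment> \<open>Exactness speaks of \<open>l > k\<close> only, non-degeneracy of all
      \<open>l\<close> from its threshold on; hence \<open>k + 1\<close>.\<close>
    show "0 \<le> k + 1" using k by simp
    show "\<forall>l\<ge>k + 1. global_minimizers (penalty_fun f \<phi> l) A \<noteq> {}"
      using eq attained by simp
    show "\<forall>l\<ge>k + 1. (\<lambda>_. x0) l \<in> global_minimizers (penalty_fun f \<phi> l) A"
      using eq x0 by simp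
    show "bounded ((\<lambda>_. x0) ` {k + 1..})"
      by (rule bounded_subset[of "{x0}"]) auto
  qed
  show "\<forall>xs\<in>global_minimizers f (M \<inter> A). exact_at f \<phi> A xs"
  proof
    fix xs assume "xs \<in> global_minimizers f (M \<inter> A)"
    then have "xs \<in> global_minimizers (penalty_fun f \<phi> (k + 1)) A"
      using eq by simp
    then have "local_minimizer_on (penalty_fun f \<phi> (k + 1)) A xs"
      by (auto simp: local_minimizer_on_def mem_global_minimizers_iff intro: exI[of _ 1])
    then show "exact_at f \<phi> A xs"
      using k by (auto simp: exact_at_def intro: exI[of _ "k + 1"])
  qed
qed

text \<open>Raising the parameter from \<open>k\<close> by \<open>n\<close> adds
  \<open>n * \<phi> (x n)\<close> to a value that is at least \<open>c\<close>, while the sum stays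
  below \<open>m\<close>; so \<open>\<phi> (x n)\<close> is at most
  \<open>(m - c) / n\<close>.\<close>

lemma penalty_values_tendsto_zero:
  assumes "\<And>x. 0 \<le> \<phi> x" "\<And>n. x n \<in> A"
    and lower: "\<And>y. y \<in> A \<Longrightarrow> ereal c \<le> penalty_fun f \<phi> k y"
    and upper: "\<And>n. penalty_fun f \<phi> (k + real n) (x n) \<le> ereal m"
  shows "(\<lambda>n. \<phi> (x n)) \<longlonglongrightarrow> 0"
proof (rule tendsto_sandwich[where f = "\<lambda>_. 0"])
  show "\<forall>\<^sub>F n in sequentially. \<phi> (x n) \<le> (m - c) / real n"
    using eventually_gt_at_top[of 0]
  proof eventually_elim
    case (elim n)
    have "ereal (c + real n * \<phi> (x n)) \<le> penalty_fun f \<phi> (k + real n) (x n)"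
      using add_right_mono[OF lower[OF assms(2)[of n]], of "ereal (real n * \<phi> (x n))"]
      by (simp add: penalty_fun_diff[of f \<phi> "k + real n" "x n" k])
    also have "\<dots> \<le> ereal m" by (rule upper)
    finally show ?case using elim by (simp add: pos_le_divide_eq mult.commute)
  qed
  show "(\<lambda>n. (m - c) / real n) \<longlonglongrightarrow> 0" by (rule lim_const_over_n)
qed (use assms(1) in auto)

theorem theorem3p10:
  fixes M A :: "'a::real_normed_vector set"
    and f :: "'a \<Rightarrow> ereal"
    and \<phi> :: "'a \<Rightarrow> real"
  assumes fin_dim: "\<exists>B :: 'a set. finite_dimensional_vector_space (*\<^sub>R) B"
    and "M \<noteq> {}" and "A \<noteq> {}"
    and f_gt_MInf: "\<And>x. f x \<noteq> -\<infinity>"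
    and phi_nonneg: "\<And>x. 0 \<le> \<phi> x"
    and M_eq: "M = {x. \<phi> x = 0}"
    and feasible: "\<exists>x \<in> M \<inter> A. f x < \<infinity>"
    and attained: "global_minimizers f (M \<inter> A) \<noteq> {}"
    and "closed A"
    and "lower_semicontinuous_on A f"
    and "lower_semicontinuous_on A \<phi>"
  shows "globally_exact f \<phi> M A \<longleftrightarrow>
           non_degenerate f \<phi> A \<and>
           (\<forall>xs \<in> global_minimizers f (M \<inter> A). exact_at f \<phi> A xs)"
proof
  assume "globally_exact f \<phi> M A"
  then show "non_degenerate f \<phi> A \<and> (\<forall>xs\<in>global_minimizers f (M \<inter> A). exact_at f \<phi> A xs)"
    using globally_exactD attained by blast
next
  assume R: "non_degenerate f \<phi> A \<and> (\<forall>xs\<in>global_minimizers f (M \<inter> A). exact_at f \<phi> A xs)"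
  then obtain k x where k: "0 \<le> k"
    and x: "\<And>l. l \<ge> k \<Longrightarrow> x l \<in> global_minimizers (penalty_fun f \<phi> l) A"
    and bdd: "bounded (x ` {k..})"
    unfolding non_degenerate_def by blast
  obtain x0 where x0: "x0 \<in> global_minimizers f (M \<inter> A)"
    using attained by blast
  then have x0MA: "x0 \<in> M \<inter> A" by (simp add: mem_global_minimizers_iff)
  have "f x0 < \<infinity>"
    using x0 feasible by (meson le_less_trans mem_global_minimizers_iff)
  then obtain m where m: "f x0 = ereal m"
    using f_gt_MInf[of x0] by (cases "f x0") auto
  have upper: "penalty_fun f \<phi> l (x l) \<le> ereal m" if "l \<ge> k" for l
    using x[OF that] x0MA m M_eq penalty_fun_feasible[of \<phi> x0 f l]
    by (auto simp: mem_global_minimizers_iff)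
  \<comment> \<open>The minimum \<open>c\<close> of F_k is finite and serves as the lower bound that
    makes \<open>\<phi>\<close> decay along the selection.\<close>
  have "penalty_fun f \<phi> k (x k) \<noteq> - \<infinity>"
    using f_gt_MInf by (cases "f (x k)") (auto simp: penalty_fun_def)
  then obtain c where c: "penalty_fun f \<phi> k (x k) = ereal c"
    using upper[of k] by (cases "penalty_fun f \<phi> k (x k)") auto
  \<comment> \<open>Sampling starts at \<open>k\<close>, so every term is a selected minimizer and
    lies in the bounded set.\<close>
  define X where "X n = x (k + real n)" for n
  have XA: "X n \<in> A" for n
    using x[of "k + real n"] by (simp add: X_def mem_global_minimizers_iff)
  have Xupper: "penalty_fun f \<phi> (k + real n) (X n) \<le> ereal m" for n
    using upper[of "k + real n"] by (simp add: X_def)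
  have phi0: "(\<lambda>n. \<phi> (X n)) \<longlonglongrightarrow> 0"
  proof (rule penalty_values_tendsto_zero[where f = f and k = k and c = c and m = m])
    show "ereal c \<le> penalty_fun f \<phi> k y" if "y \<in> A" for y
      using x[of k] that by (simp add: mem_global_minimizers_iff c[symmetric])
  qed (use phi_nonneg XA Xupper in auto)
  obtain r where r: "\<And>n. X n \<in> cball 0 r"
    using bdd by (force simp: bounded_iff X_def)
  have "compact (A \<inter> cball 0 r)"
    using compact_cball_finite_dimensional[OF fin_dim] \<open>closed A\<close> by (rule closed_Int_compact[rotated])
  then obtain xs s where xsA: "xs \<in> A" and s: "strict_mono s" and lim: "(X \<circ> s) \<longlonglongrightarrow> xs"
    unfolding compact_def using XA r by (metis IntD1 IntI)
  have XsA: "(X \<circ> s) n \<in> A" for n using XA by simp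
  \<comment> \<open>The values tend to 0 but need not be 0, so semicontinuity is applied with each
    bound \<open>e\<close>; \<open>0 + e\<close> fits \<open>field_le_epsilon\<close>.\<close>
  have "\<phi> xs \<le> 0 + e" if "e > 0" for e
  proof -
    have "\<forall>\<^sub>F n in sequentially. \<phi> ((X \<circ> s) n) < e"
      using order_tendstoD(2)[OF LIMSEQ_subseq_LIMSEQ[OF phi0 s] that] by (simp add: o_def)
    then have "\<forall>\<^sub>F n in sequentially. \<phi> ((X \<circ> s) n) \<le> e"
      by eventually_elim simp
    then show ?thesis
      using lower_semicontinuous_on_sequentially_le
        [OF \<open>lower_semicontinuous_on A \<phi>\<close> xsA XsA lim] by simp
  qed
  then have "\<phi> xs \<le> 0" by (rule field_le_epsilon)
  then have phixs: "\<phi> xs = 0" using phi_nonneg[of xs] by simp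
  have "f (X n) \<le> ereal m" for n
  proof -
    have "f (X n) \<le> penalty_fun f \<phi> (k + real n) (X n)"
      using k phi_nonneg[of "X n"] by (simp add: penalty_fun_def ereal_le_add_self)
    then show ?thesis using Xupper by (rule order_trans)
  qed
  then have "f xs \<le> ereal m"
    using lower_semicontinuous_on_sequentially_le
        [OF \<open>lower_semicontinuous_on A f\<close> xsA XsA lim] by simp
  then have xs: "xs \<in> global_minimizers f (M \<inter> A)"
    using x0 xsA phixs M_eq m by (auto simp: mem_global_minimizers_iff intro: order_trans)
  then have "f xs = ereal m"
    using \<open>f xs \<le> ereal m\<close> x0 m xs by (metis antisym mem_global_minimizers_iff)
  \<comment> \<open>The cluster point is optimal, so local exactness applies to it.\<close>
  from xs R obtain k' d where k': "0 \<le> k'" and d: "d > 0"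
    and loc: "\<And>y. y \<in> A \<inter> ball xs d \<Longrightarrow> penalty_fun f \<phi> k' xs \<le> penalty_fun f \<phi> k' y"
    unfolding exact_at_def local_minimizer_on_def by blast
  have "\<forall>\<^sub>F n in sequentially. (X \<circ> s) n \<in> ball xs d"
    using lim d by (simp add: tendsto_iff dist_commute)
  moreover have "\<forall>\<^sub>F n in sequentially. k' \<le> real n"
    by (metis eventually_sequentiallyI nat_ceiling_le_eq)
  ultimately have "\<forall>\<^sub>F n in sequentially. (X \<circ> s) n \<in> ball xs d \<and> k' \<le> real n"
    by (rule eventually_conj)
  then obtain n where n: "X (s n) \<in> ball xs d" "k' \<le> real n"
    by (auto simp: eventually_sequentially)
  \<comment> \<open>\<open>N\<close> is the parameter for which \<open>X (s n)\<close> was selected.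
    As \<open>s n\<close> is at least \<open>n\<close>, it exceeds or equals \<open>k'\<close>, so
    F_N dominates the locally exact penalty.\<close>
  define N where "N = k + real (s n)"
  have N: "k' \<le> N" "k \<le> N"
    using n(2) k seq_suble[OF s, of n] by (simp_all add: N_def)
  have "ereal m = penalty_fun f \<phi> k' xs"
    using \<open>f xs = ereal m\<close> phixs by (simp add: penalty_fun_feasible)
  also have "\<dots> \<le> penalty_fun f \<phi> k' (X (s n))"
    using loc n(1) XA by blast
  also have "\<dots> \<le> penalty_fun f \<phi> N (X (s n))"
    using N phi_nonneg[of "X (s n)"]
    by (simp add: penalty_fun_diff[of f \<phi> N _ k'] ereal_le_add_self)
  \<comment> \<open>The bound at the single point \<open>X (s n)\<close> becomes global because that
    point minimizes F_N over all of \<open>A\<close>.\<close>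
  finally have "ereal m \<le> penalty_fun f \<phi> N y" if "y \<in> A" for y
    using x[OF N(2)] that by (auto simp: mem_global_minimizers_iff X_def N_def intro: order_trans)
  then show "globally_exact f \<phi> M A"
    using globally_exactI[where f = f and N = N, OF phi_nonneg M_eq x0MA m] N k by simp
qed

end
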